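(* There exist $\mathfrak{c}$ pairwise non-homeomorphic topologies $\tau\in\mathcal{L}$ such that $(\mathbb{R},\tau)$ is a metrizable space of first category.
   Context: $\mathfrak{c}=|\mathbb{R}|$. $\eta$ denotes the Euclidean topology on $\mathbb{R}$. $\mathcal{L}$ denotes the family of all Hausdorff topologies $\tau$ on the set $\mathbb{R}$ with $\tau\subset\eta$. *)

theory Defs
  imports "HOL-Analysis.Analysis" "HOL-Library.Equipollence"
begin

definition nowhere_dense_in :: "'a topology \<Rightarrow> 'a set \<Rightarrow> bool" where
  "nowhere_dense_in X S \<longleftrightarrow> S \<subseteq> topspace X \<and> X interior_of (X closure_of S) = {}"

definition first_category_space :: "'a topology \<Rightarrow> bool" where
  "first_category_space X \<longleftrightarrow>
     (\<exists>\<F>. countable \<F> \<and> (\<forall>S\<in>\<F>. nowhere_dense_in X S) \<and> \<Union>\<F> = topspace X)"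

definition L_topologies :: "real topology set" where
  "L_topologies = {\<tau>. topspace \<tau> = UNIV \<and> Hausdorff_space \<tau> \<and>
                        (\<forall>S. openin \<tau> S \<longrightarrow> open S)}"

end

theory Submission
  imports Defs
begin

text \<open>
  The group norm \<open>sol_norm\<close> turns the real line into a dense line in the dyadic solenoid: the
  points near \<open>x\<close> lie on countably many sheets, one around each \<open>x + 2 ^ n * j\<close> with \<open>n\<close> large.
  Paths in this coarse topology stay on their sheets, so a homeomorphism between any two
  topologies lying between it and the Euclidean one is also a Euclidean homeomorphism.

  Given a countable set \<open>D\<close>, refine the norm topology by a function \<open>g\<close> that is continuous for the
  Euclidean topology everywhere and for the norm exactly off \<open>D\<close>; near a point of \<open>D\<close> it has bumps on the
  sheets \<open>2 ^ n\<close>, of every small height infinitely often. Off \<open>D\<close> nothing changes, which gives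
  first category; the points of \<open>D\<close> are recognised by how Euclidean segments sit in their
  neighbourhoods. Hence the order type of \<open>D\<close> up to reversal is a topological invariant, and
  countable sets \<open>D\<close> can encode arbitrary sets of natural numbers.
\<close>

section \<open>The solenoidal norm\<close>

text \<open>On nonzero integers this is the 2-adic absolute value. The term \<open>1 / 2 ^ n\<close>
  is the price for moving by multiples of \<open>2 ^ n\<close>, so \<open>2 ^ n\<close> tends to 0
  while short distances stay Euclidean.\<close>

definition sol_norm :: "real \<Rightarrow> real" where
  "sol_norm x = (INF (n, j)\<in>(UNIV :: (nat \<times> int) set). \<bar>x - 2 ^ n * of_int j\<bar> + 1 / 2 ^ n)"

lemma sol_norm_less_iff:
  "sol_norm x < e \<longleftrightarrow> (\<exists>n j. \<bar>x - 2 ^ n * of_int j\<bar> + 1 / 2 ^ n < e)"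
proof -
  have "bdd_below (range (\<lambda>(n :: nat, j :: int). \<bar>x - 2 ^ n * of_int j\<bar> + 1 / 2 ^ n))"
    by (rule bdd_belowI [of _ 0]) auto
  then show ?thesis
    unfolding sol_norm_def by (subst cINF_less_iff) auto
qed

lemma sol_norm_lessE:
  assumes "sol_norm x < e"
  obtains n j where "\<bar>x - 2 ^ n * real_of_int j\<bar> + 1 / 2 ^ n < e"
  using assms unfolding sol_norm_less_iff by auto

lemma sol_norm_le: "sol_norm x \<le> \<bar>x - 2 ^ n * of_int j\<bar> + 1 / 2 ^ n"
  using sol_norm_less_iff [of x "sol_norm x"] by (meson less_irrefl not_le)

lemma sol_norm_nonneg [simp]: "0 \<le> sol_norm x"
proof (rule ccontr)
  assume "\<not> ?thesis"
  then obtain n j where "\<bar>x - 2 ^ n * real_of_int j\<bar> + 1 / 2 ^ n < 0"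
    using sol_norm_less_iff [of x 0] by auto
  then show False
    by (smt (verit) divide_nonneg_nonneg zero_le_power)
qed

lemma ex_divide_power2_less:
  assumes "0 < (e :: real)"
  shows "\<exists>n. c / 2 ^ n < e"
proof -
  have "(\<lambda>n. c * (1 / 2) ^ n) \<longlonglongrightarrow> c * 0"
    by (intro tendsto_intros LIMSEQ_power_zero) auto
  then have "\<forall>\<^sub>F n in sequentially. c * (1 / 2) ^ n < e"
    using assms by (intro order_tendstoD) auto
  then show ?thesis
    by (auto simp: eventually_sequentially power_one_over field_simps)
qed

text \<open>Take \<open>j = 0\<close> and let \<open>n\<close> grow.\<close>

lemma sol_norm_le_abs: "sol_norm x \<le> \<bar>x\<bar>"
proof (rule field_le_epsilon)
  fix e :: real
  assume "0 < e"
  then obtain n where "1 / 2 ^ n < e"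
    using ex_divide_power2_less by blast
  then show "sol_norm x \<le> \<bar>x\<bar> + e"
    using sol_norm_le [of x n 0] by simp
qed

lemma sol_norm_minus [simp]: "sol_norm (- x) = sol_norm x"
proof -
  have "sol_norm (- x) \<le> sol_norm x" for x
  proof (rule ccontr)
    assume "\<not> ?thesis"
    then obtain n j where "\<bar>x - 2 ^ n * real_of_int j\<bar> + 1 / 2 ^ n < sol_norm (- x)"
      by (auto simp: not_le elim: sol_norm_lessE)
    moreover have "sol_norm (- x) \<le> \<bar>- x - 2 ^ n * of_int (- j)\<bar> + 1 / 2 ^ n"
      by (rule sol_norm_le)
    ultimately show False
      by (simp add: abs_minus_commute)
  qed
  from this [of x] this [of "- x"] show ?thesis
    by simp
qed

lemma sol_norm_commute: "sol_norm (x - y) = sol_norm (y - x)"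
  using sol_norm_minus [of "y - x"] by simp

text \<open>The sum of multiples of \<open>2 ^ n\<close> and \<open>2 ^ m\<close> is a multiple of
  the smaller power, whose price is one of the two already paid.\<close>

lemma sol_norm_triangle: "sol_norm (x + y) \<le> sol_norm x + sol_norm y"
proof (rule field_le_epsilon)
  fix e :: real
  assume "0 < e"
  then have "sol_norm x < sol_norm x + e / 2" "sol_norm y < sol_norm y + e / 2"
    by auto
  then obtain n i m j
    where ni: "\<bar>x - 2 ^ n * real_of_int i\<bar> + 1 / 2 ^ n < sol_norm x + e / 2"
      and mj: "\<bar>y - 2 ^ m * real_of_int j\<bar> + 1 / 2 ^ m < sol_norm y + e / 2"
    unfolding sol_norm_less_iff by blast
  have "\<exists>p q. 2 ^ n * i + 2 ^ m * j = 2 ^ p * q \<and> 1 / 2 ^ p \<le> 1 / 2 ^ n + 1 / (2 ^ m :: real)"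
  proof (cases n m rule: le_cases)
    case le
    then have "2 ^ n * i + 2 ^ m * j = 2 ^ n * (i + 2 ^ (m - n) * j)"
      by (simp add: algebra_simps flip: power_add)
    then show ?thesis
      by (intro exI [of _ n] exI [of _ "i + 2 ^ (m - n) * j"]) auto
  next
    case ge
    then have "2 ^ n * i + 2 ^ m * j = 2 ^ m * (2 ^ (n - m) * i + j)"
      by (simp add: algebra_simps flip: power_add)
    then show ?thesis
      by (intro exI [of _ m] exI [of _ "2 ^ (n - m) * i + j"]) auto
  qed
  then obtain p q where pq: "2 ^ n * i + 2 ^ m * j = 2 ^ p * q"
      "1 / 2 ^ p \<le> 1 / 2 ^ n + 1 / (2 ^ m :: real)"
    by blast
  have "real_of_int (2 ^ n * i + 2 ^ m * j) = of_int (2 ^ p * q)"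
    by (simp only: pq)
  then have "x + y - 2 ^ p * real_of_int q
      = (x - 2 ^ n * real_of_int i) + (y - 2 ^ m * real_of_int j)"
    by simp
  then show "sol_norm (x + y) \<le> sol_norm x + sol_norm y + e"
    using sol_norm_le [of "x + y" p q] ni mj pq(2) by linarith
qed

lemma sol_norm_triangle_diff: "sol_norm (x - z) \<le> sol_norm (x - y) + sol_norm (y - z)"
  using sol_norm_triangle [of "x - y" "y - z"] by simp

text \<open>Nonzero multiples \<open>2 ^ n * j\<close> have modulus at least 1, so none is closer to
  \<open>x\<close> than 0 is.\<close>

lemma sol_norm_eq_abs:
  assumes "\<bar>x\<bar> \<le> 1 / 2"
  shows "sol_norm x = \<bar>x\<bar>"
proof (rule ccontr)
  assume "sol_norm x \<noteq> \<bar>x\<bar>"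
  then have "sol_norm x < \<bar>x\<bar>"
    using sol_norm_le_abs [of x] by simp
  then obtain n j where nj: "\<bar>x - 2 ^ n * real_of_int j\<bar> + 1 / 2 ^ n < \<bar>x\<bar>"
    unfolding sol_norm_less_iff by blast
  have pos: "0 < 1 / (2 ^ n :: real)"
    by simp
  show False
  proof (cases "j = 0")
    case True
    with nj pos show False by simp
  next
    case False
    have "2 ^ n * j \<noteq> 0"
      using False by simp
    then have "1 \<le> \<bar>2 ^ n * j\<bar>"
      by linarith
    then have "1 \<le> \<bar>real_of_int (2 ^ n * j)\<bar>"
      by (metis of_int_1_le_iff of_int_abs)
    then have "1 \<le> \<bar>2 ^ n * real_of_int j\<bar>"
      by simp
    with nj pos assms show False by linarith
  qed
qed

lemma sol_norm_eq_0_iff [simp]: "sol_norm x = 0 \<longleftrightarrow> x = 0"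
proof
  assume 0: "sol_norm x = 0"
  show "x = 0"
  proof (rule ccontr)
    assume x: "x \<noteq> 0"
    \<comment> \<open>The first bound excludes \<open>j = 0\<close>; the second forces
      \<open>2 ^ n > 2 * \<bar>x\<bar>\<close>, which puts the nonzero multiples too far from
      \<open>x\<close>.\<close>
    define e where "e = min (\<bar>x\<bar> / 2) (1 / (2 * \<bar>x\<bar>))"
    have "0 < e"
      using x by (simp add: e_def)
    with 0 have "sol_norm x < e"
      by simp
    then obtain n j where nj: "\<bar>x - 2 ^ n * real_of_int j\<bar> + 1 / 2 ^ n < e"
      by (rule sol_norm_lessE)
    have pos: "0 < 1 / (2 ^ n :: real)"
      by simp
    have e: "e \<le> \<bar>x\<bar> / 2" "e \<le> 1 / (2 * \<bar>x\<bar>)"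
      unfolding e_def by (rule min.cobounded1, rule min.cobounded2)
    show False
    proof (cases "j = 0")
      case True
      then have "\<bar>x\<bar> + 1 / 2 ^ n < e"
        using nj by simp
      with e(1) pos show False
        by linarith
    next
      case False
      have "1 / 2 ^ n < 1 / (2 * \<bar>x\<bar>)"
        using nj e(2) by linarith
      then have "2 * \<bar>x\<bar> < 2 ^ n"
        using x by (simp add: divide_less_eq less_divide_eq mult.commute)
      moreover have "(2 :: real) ^ n * 1 \<le> 2 ^ n * \<bar>of_int j\<bar>"
        using False by (intro mult_left_mono) auto
      moreover have "2 ^ n * \<bar>of_int j\<bar> = \<bar>2 ^ n * real_of_int j\<bar>"
        by (simp add: abs_mult)
      moreover have "\<bar>x - 2 ^ n * real_of_int j\<bar> < \<bar>x\<bar> / 2"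
        using nj pos e(1) by linarith
      ultimately show False
        by linarith
    qed
  qed
qed (use sol_norm_eq_abs [of 0] in simp)

lemma sol_norm_0 [simp]: "sol_norm 0 = 0"
  by simp

lemma sol_norm_power_le: "sol_norm (2 ^ n) \<le> 1 / 2 ^ n"
  using sol_norm_le [of "2 ^ n" n 1] by simp

text \<open>A price below \<open>1 / 2 ^ k\<close> requires \<open>n > k\<close>, but
  \<open>2 ^ k - 2 ^ l\<close> is not divisible by \<open>2 ^ Suc k\<close>, so it has distance at
  least 1 from every multiple of \<open>2 ^ n\<close>. This separation later keeps the bumps
  disjoint.\<close>

lemma sol_norm_power_diff_ge:
  assumes "k < l"
  shows "1 / 2 ^ k \<le> sol_norm (2 ^ k - 2 ^ l)"
proof (rule ccontr)
  assume "\<not> ?thesis"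
  then obtain n j where nj: "\<bar>2 ^ k - 2 ^ l - 2 ^ n * real_of_int j\<bar> + 1 / 2 ^ n < 1 / 2 ^ k"
    by (auto simp: not_le elim: sol_norm_lessE)
  then have "1 / 2 ^ n < (1 / 2 ^ k :: real)"
    by linarith
  then have "(2 :: real) ^ k < 2 ^ n"
    by (simp add: field_simps)
  then have "k < n"
    by simp
  with assms have "2 ^ Suc k dvd (2 ^ l + 2 ^ n * j)"
    by (intro dvd_add dvd_mult2 le_imp_power_dvd) auto
  moreover have "\<not> 2 ^ Suc k dvd (2 ^ k :: int)"
    by (simp add: power_dvd_imp_le)
  ultimately have "2 ^ k - 2 ^ l - 2 ^ n * j \<noteq> 0"
    by (smt (verit) diff_diff_add right_minus_eq)
  then have "1 \<le> \<bar>2 ^ k - 2 ^ l - 2 ^ n * j\<bar>"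
    by linarith
  then have "1 \<le> \<bar>real_of_int (2 ^ k - 2 ^ l - 2 ^ n * j)\<bar>"
    by (metis of_int_1_le_iff of_int_abs)
  moreover have "1 / 2 ^ k \<le> (1 :: real)"
    by simp
  moreover have "0 < 1 / (2 ^ n :: real)"
    by simp
  ultimately show False
    using nj by simp
qed

text \<open>The balls carrying the bumps avoid a Euclidean neighbourhood of 0: the radius forces
  \<open>n > k\<close>, so \<open>x\<close> lies within 1/4 of the nonzero integer
  \<open>2 ^ k + 2 ^ n * j\<close>.\<close>

lemma sol_norm_near_power:
  assumes "sol_norm (x - 2 ^ k) < 1 / (4 * 2 ^ k)"
  shows "1 / 2 < \<bar>x\<bar>"
proof -
  obtain n j where nj: "\<bar>x - 2 ^ k - 2 ^ n * real_of_int j\<bar> + 1 / 2 ^ n < 1 / (4 * 2 ^ k)"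
    using assms by (rule sol_norm_lessE)
  have "1 / (4 * 2 ^ k) \<le> 1 / (2 ^ k :: real)"
    by (simp add: field_simps)
  with nj have "1 / 2 ^ n < (1 / 2 ^ k :: real)"
    by linarith
  then have "(2 :: real) ^ k < 2 ^ n"
    by (simp add: field_simps)
  then have "k < n"
    by simp
  then have "2 ^ Suc k dvd (2 ^ n * j)"
    by (intro dvd_mult2 le_imp_power_dvd) auto
  moreover have "\<not> 2 ^ Suc k dvd (2 ^ k :: int)"
    by (simp add: power_dvd_imp_le)
  ultimately have "2 ^ k + 2 ^ n * j \<noteq> 0"
    by (metis add_eq_0_iff dvd_minus_iff minus_minus)
  then have "1 \<le> \<bar>2 ^ k + 2 ^ n * j\<bar>"
    by linarith
  then have "1 \<le> \<bar>real_of_int (2 ^ k + 2 ^ n * j)\<bar>"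
    by (metis of_int_1_le_iff of_int_abs)
  then have "1 \<le> \<bar>2 ^ k + 2 ^ n * real_of_int j\<bar>"
    by simp
  moreover have "1 / (4 * 2 ^ k) \<le> (1 / 4 :: real)"
    by (simp add: field_simps)
  moreover have "0 < 1 / (2 ^ n :: real)"
    by simp
  ultimately show ?thesis
    using nj by linarith
qed

section \<open>Topologies finer than the solenoidal one\<close>

text \<open>The metric of the graph of \<open>g\<close>; it induces the coarsest refinement of the
  norm topology that makes \<open>g\<close> continuous.\<close>

definition refined_topology :: "(real \<Rightarrow> real) \<Rightarrow> real topology" where
  "refined_topology g =
     Metric_space.mtopology UNIV (\<lambda>x y. sol_norm (x - y) + \<bar>g x - g y\<bar>)"

lemma Metric_space_refined:
  "Metric_space UNIV (\<lambda>x y. sol_norm (x - y) + \<bar>g x - g y\<bar>)"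
proof
  fix x y z :: real
  show "0 \<le> sol_norm (x - y) + \<bar>g x - g y\<bar>"
    by simp
  show "sol_norm (x - y) + \<bar>g x - g y\<bar> = sol_norm (y - x) + \<bar>g y - g x\<bar>"
    using sol_norm_commute by (simp add: abs_minus_commute)
  have "sol_norm (x - y) + \<bar>g x - g y\<bar> = 0 \<longleftrightarrow> sol_norm (x - y) = 0 \<and> \<bar>g x - g y\<bar> = 0"
    by (rule add_nonneg_eq_0_iff) auto
  then show "sol_norm (x - y) + \<bar>g x - g y\<bar> = 0 \<longleftrightarrow> x = y"
    by auto
  show "sol_norm (x - z) + \<bar>g x - g z\<bar>
      \<le> sol_norm (x - y) + \<bar>g x - g y\<bar> + (sol_norm (y - z) + \<bar>g y - g z\<bar>)"
    using sol_norm_triangle_diff [of x z y] by linarith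
qed

lemma topspace_refined [simp]: "topspace (refined_topology g) = UNIV"
  unfolding refined_topology_def
  by (simp add: Metric_space.topspace_mtopology [OF Metric_space_refined])

lemma metrizable_refined: "metrizable_space (refined_topology g)"
  unfolding refined_topology_def
  by (rule Metric_space.metrizable_space_mtopology [OF Metric_space_refined])

lemma Hausdorff_refined: "Hausdorff_space (refined_topology g)"
  by (simp add: metrizable_imp_Hausdorff_space metrizable_refined)

lemma openin_refined:
  "openin (refined_topology g) U \<longleftrightarrow>
     (\<forall>x\<in>U. \<exists>e>0. \<forall>y. sol_norm (y - x) + \<bar>g y - g x\<bar> < e \<longrightarrow> y \<in> U)"
  unfolding refined_topology_def Metric_space.openin_mtopology [OF Metric_space_refined]
    Metric_space.mball_def [OF Metric_space_refined]
  by (auto simp: subset_iff sol_norm_commute abs_minus_commute)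

lemma openin_refined_ball:
  "openin (refined_topology g) {y. sol_norm (y - x) + \<bar>g y - g x\<bar> < e}"
  unfolding openin_refined
proof clarify
  fix y
  assume y: "sol_norm (y - x) + \<bar>g y - g x\<bar> < e"
  show "\<exists>r>0. \<forall>z. sol_norm (z - y) + \<bar>g z - g y\<bar> < r
      \<longrightarrow> z \<in> {y. sol_norm (y - x) + \<bar>g y - g x\<bar> < e}"
  proof (intro exI conjI allI impI)
    show "0 < e - (sol_norm (y - x) + \<bar>g y - g x\<bar>)"
      using y by simp
    fix z
    assume "sol_norm (z - y) + \<bar>g z - g y\<bar> < e - (sol_norm (y - x) + \<bar>g y - g x\<bar>)"
    then show "z \<in> {y. sol_norm (y - x) + \<bar>g y - g x\<bar> < e}"
      using sol_norm_triangle_diff [of z x y] by auto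
  qed
qed

lemma openin_refined_sol_ball: "openin (refined_topology g) {y. sol_norm (y - x) < e}"
  unfolding openin_refined
proof clarify
  fix y
  assume y: "sol_norm (y - x) < e"
  show "\<exists>r>0. \<forall>z. sol_norm (z - y) + \<bar>g z - g y\<bar> < r \<longrightarrow> z \<in> {y. sol_norm (y - x) < e}"
  proof (intro exI conjI allI impI)
    show "0 < e - sol_norm (y - x)"
      using y by simp
    fix z
    assume "sol_norm (z - y) + \<bar>g z - g y\<bar> < e - sol_norm (y - x)"
    then show "z \<in> {y. sol_norm (y - x) < e}"
      using sol_norm_triangle_diff [of z x y] by auto
  qed
qed

text \<open>For Euclidean-close points \<open>sol_norm_le_abs\<close> controls the first summand of
  the metric, continuity of \<open>g\<close> the second.\<close>

lemma open_if_openin_refined: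
  assumes g: "continuous_on UNIV g" and U: "openin (refined_topology g) U"
  shows "open U"
  unfolding open_dist
proof
  fix x
  assume "x \<in> U"
  with U obtain e where e: "0 < e" "\<And>y. sol_norm (y - x) + \<bar>g y - g x\<bar> < e \<Longrightarrow> y \<in> U"
    unfolding openin_refined by blast
  from g \<open>0 < e\<close> obtain d where d: "0 < d" "\<And>y. dist y x < d \<Longrightarrow> dist (g y) (g x) < e / 2"
    unfolding continuous_on_iff by (metis UNIV_I half_gt_zero)
  show "\<exists>r>0. \<forall>y. dist y x < r \<longrightarrow> y \<in> U"
  proof (intro exI conjI allI impI)
    show "0 < min d (e / 2)"
      using d e by simp
    fix y
    assume "dist y x < min d (e / 2)"
    then show "y \<in> U"
      using d(2) [of y] sol_norm_le_abs [of "y - x"]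
      by (intro e(2)) (auto simp: dist_real_def)
  qed
qed

text \<open>A set of sheets that is periodic modulo a power of two is open; together with its complement
  it separates any two sheets, which confines paths to a single sheet.\<close>

lemma openin_sheets:
  assumes P: "\<And>m i. P m \<Longrightarrow> P (m + 2 ^ p * i)"
  shows "openin (refined_topology g) {w. \<exists>m. P m \<and> \<bar>w - c - of_int m\<bar> < 1 / 4}"
  unfolding openin_refined
proof clarify
  fix w m
  assume m: "P m" "\<bar>w - c - real_of_int m\<bar> < 1 / 4"
  \<comment> \<open>The second bound forces \<open>n > p\<close>, so that \<open>m\<close> changes
    by multiples of \<open>2 ^ p\<close> only; the first keeps the moved point within 1/4 of its new
    centre.\<close>
  define e where "e = min (1 / 4 - \<bar>w - c - real_of_int m\<bar>) (1 / 2 ^ p)"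
  have e: "0 < e"
    using m by (simp add: e_def)
  have "\<exists>m. P m \<and> \<bar>v - c - real_of_int m\<bar> < 1 / 4" if v: "sol_norm (v - w) < e" for v
  proof -
    obtain n j where nj: "\<bar>v - w - 2 ^ n * real_of_int j\<bar> + 1 / 2 ^ n < e"
      using v by (rule sol_norm_lessE)
    then have "1 / 2 ^ n < (1 / 2 ^ p :: real)"
      unfolding e_def by linarith
    then have "(2 :: real) ^ p < 2 ^ n"
      by (simp add: field_simps)
    then have "p < n"
      by simp
    then have "2 ^ n * j = 2 ^ p * (2 ^ (n - p) * j)"
      by (simp flip: power_add mult.assoc)
    then have P': "P (m + 2 ^ n * j)"
      using P [OF m(1)] by metis
    have "0 < 1 / (2 ^ n :: real)"
      by simp
    moreover have "real_of_int (m + 2 ^ n * j) = real_of_int m + 2 ^ n * real_of_int j"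
      by simp
    ultimately have "\<bar>v - c - real_of_int (m + 2 ^ n * j)\<bar> < 1 / 4"
      using nj unfolding e_def by linarith
    with P' show ?thesis
      by blast
  qed
  then show "\<exists>e>0. \<forall>v. sol_norm (v - w) + \<bar>g v - g w\<bar> < e
      \<longrightarrow> v \<in> {w. \<exists>m. P m \<and> \<bar>w - c - real_of_int m\<bar> < 1 / 4}"
    using e by (intro exI [of _ e]) (smt (verit) mem_Collect_eq)
qed

text \<open>A short interval has a connected image inside a small norm ball around
  \<open>f x\<close>, and such an image cannot leave the sheet through \<open>f x\<close>.\<close>

lemma continuous_on_if_continuous_refined:
  fixes f :: "real \<Rightarrow> real"
  assumes f: "continuous_map euclidean (refined_topology g) f"
  shows "continuous_on UNIV f"
  unfolding continuous_on_iff
proof (intro ballI allI impI)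
  fix x e0 :: real
  assume "0 < e0"
  define e where "e = min e0 (1 / 4)"
  have e: "0 < e"
    using \<open>0 < e0\<close> by (simp add: e_def)
  define B where "B = {y. sol_norm (y - f x) < e}"
  have "openin euclidean {t \<in> topspace euclidean. f t \<in> B}"
    unfolding B_def
    by (rule openin_continuous_map_preimage [OF f openin_refined_sol_ball])
  then have "open {t. f t \<in> B}"
    by simp
  moreover have "x \<in> {t. f t \<in> B}"
    using e by (simp add: B_def)
  ultimately obtain d where d: "0 < d" "ball x d \<subseteq> {t. f t \<in> B}"
    using open_contains_ball by blast
  have "connectedin euclidean (ball x d)"
    by simp
  then have conn: "connectedin (refined_topology g) (f ` ball x d)"
    by (rule connectedin_continuous_map_image [OF f])
  have "\<bar>f t - f x\<bar> < e" if t: "t \<in> ball x d" for t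
  proof -
    have "sol_norm (f t - f x) < e"
      using d t by (auto simp: B_def)
    then obtain n j where nj: "\<bar>f t - f x - 2 ^ n * real_of_int j\<bar> + 1 / 2 ^ n < e"
      by (rule sol_norm_lessE)
    have pos: "0 < 1 / (2 ^ n :: real)"
      by simp
    \<comment> \<open>Large enough for \<open>2 ^ p > \<bar>2 ^ n * j\<bar>\<close>, so divisibility
      of \<open>2 ^ n * j\<close> by \<open>2 ^ p\<close> puts \<open>f t\<close> on the sheet of
      \<open>f x\<close>.\<close>
    define p where "p = nat \<bar>2 ^ n * j\<bar>"
    define S where "S P = {w. \<exists>m. P m \<and> \<bar>w - f x - real_of_int m\<bar> < 1 / 4}" for P
    have "openin (refined_topology g) (S (\<lambda>m. 2 ^ p dvd m))"
      unfolding S_def by (rule openin_sheets [where p = p]) simp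
    moreover have "openin (refined_topology g) (S (\<lambda>m. \<not> 2 ^ p dvd m))"
      unfolding S_def by (rule openin_sheets [where p = p]) (simp add: dvd_add_left_iff)
    moreover have "f ` ball x d \<subseteq> S (\<lambda>m. 2 ^ p dvd m) \<union> S (\<lambda>m. \<not> 2 ^ p dvd m)"
    proof
      fix w
      assume "w \<in> f ` ball x d"
      then have "sol_norm (w - f x) < e"
        using d by (auto simp: B_def)
      then obtain n' j' where nj': "\<bar>w - f x - 2 ^ n' * real_of_int j'\<bar> + 1 / 2 ^ n' < e"
        by (rule sol_norm_lessE)
      have "0 < 1 / (2 ^ n' :: real)"
        by simp
      moreover have "real_of_int (2 ^ n' * j') = 2 ^ n' * real_of_int j'"
        by simp
      ultimately have "\<bar>w - f x - real_of_int (2 ^ n' * j')\<bar> < 1 / 4"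
        using nj' unfolding e_def by linarith
      then show "w \<in> S (\<lambda>m. 2 ^ p dvd m) \<union> S (\<lambda>m. \<not> 2 ^ p dvd m)"
        unfolding S_def by blast
    qed
    moreover have "S (\<lambda>m. 2 ^ p dvd m) \<inter> S (\<lambda>m. \<not> 2 ^ p dvd m) = {}"
    proof -
      have "m = m'" if "\<bar>w - f x - real_of_int m\<bar> < 1 / 4" "\<bar>w - f x - real_of_int m'\<bar> < 1 / 4"
        for w m m'
        using that by linarith
      then show ?thesis
        unfolding S_def by blast
    qed
    moreover have "f x \<in> S (\<lambda>m. 2 ^ p dvd m) \<inter> f ` ball x d"
      using d(1) unfolding S_def by (auto intro!: exI [of _ 0])
    ultimately have "f t \<notin> S (\<lambda>m. \<not> 2 ^ p dvd m)"
      using conn t unfolding connectedin by blast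
    moreover have "\<bar>f t - f x - real_of_int (2 ^ n * j)\<bar> < 1 / 4"
    proof -
      have "real_of_int (2 ^ n * j) = 2 ^ n * real_of_int j"
        by simp
      then show ?thesis
        using nj pos unfolding e_def by linarith
    qed
    ultimately have "2 ^ p dvd 2 ^ n * j"
      unfolding S_def by blast
    moreover have "\<bar>2 ^ n * j\<bar> < 2 ^ p"
    proof -
      have "p < 2 ^ p"
        by (rule less_exp)
      then have "int p < 2 ^ p"
        by (metis of_nat_less_iff of_nat_numeral of_nat_power)
      then show ?thesis
        by (simp add: p_def)
    qed
    ultimately have "2 ^ n * j = 0"
      using zdvd_imp_le [of "2 ^ p" "\<bar>2 ^ n * j\<bar>"] by force
    then have "\<bar>f t - f x\<bar> + 1 / 2 ^ n < e"
      using nj by simp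
    with pos show ?thesis
      by linarith
  qed
  with d(1) show "\<exists>d>0. \<forall>t\<in>UNIV. dist t x < d \<longrightarrow> dist (f t) (f x) < e0"
    by (intro exI [of _ d]) (auto simp: dist_real_def e_def abs_minus_commute)
qed

section \<open>Bump functions\<close>

text \<open>The neighbourhood filter of the norm topology, in a form to which the calculus of limits
  along filters applies.\<close>

definition sol_nhds :: "real \<Rightarrow> real filter" where
  "sol_nhds x = filtercomap (\<lambda>y. sol_norm (y - x)) (nhds 0)"

lemma eventually_sol_nhds:
  "eventually P (sol_nhds x) \<longleftrightarrow> (\<exists>e>0. \<forall>y. sol_norm (y - x) < e \<longrightarrow> P y)"
proof
  assume "eventually P (sol_nhds x)"
  then obtain Q where Q: "eventually Q (nhds 0)" "\<And>y. Q (sol_norm (y - x)) \<Longrightarrow> P y"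
    unfolding sol_nhds_def eventually_filtercomap by blast
  then obtain e where "0 < e" "\<And>y. dist y 0 < e \<Longrightarrow> Q y"
    unfolding eventually_nhds_metric by blast
  with Q(2) show "\<exists>e>0. \<forall>y. sol_norm (y - x) < e \<longrightarrow> P y"
    by (intro exI [of _ e]) auto
next
  assume "\<exists>e>0. \<forall>y. sol_norm (y - x) < e \<longrightarrow> P y"
  then obtain e where e: "0 < e" "\<And>y. sol_norm (y - x) < e \<Longrightarrow> P y"
    by blast
  then show "eventually P (sol_nhds x)"
    unfolding sol_nhds_def eventually_filtercomap eventually_nhds_metric
    by (intro exI [of _ "\<lambda>y. y < e"]) auto
qed

lemma sol_nhds_neq_bot [simp]: "sol_nhds x \<noteq> bot"
proof
  assume "sol_nhds x = bot"
  then have "eventually (\<lambda>y. False) (sol_nhds x)"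
    by simp
  then show False
    unfolding eventually_sol_nhds by (metis cancel_comm_monoid_add_class.diff_cancel sol_norm_0)
qed

lemma tendsto_sol_norm: "((\<lambda>y. sol_norm (y - a)) \<longlongrightarrow> sol_norm (x - a)) (sol_nhds x)"
  unfolding tendsto_iff eventually_sol_nhds
proof (intro allI impI)
  fix e :: real
  assume "0 < e"
  moreover have "dist (sol_norm (y - a)) (sol_norm (x - a)) \<le> sol_norm (y - x)" for y
    using sol_norm_triangle_diff [of y a x] sol_norm_triangle_diff [of x a y]
    by (simp add: dist_real_def sol_norm_commute [of x y])
  ultimately show "\<exists>d>0. \<forall>y. sol_norm (y - x) < d
      \<longrightarrow> dist (sol_norm (y - a)) (sol_norm (x - a)) < e"
    by (meson le_less_trans)
qed

lemma tendsto_sol_nhds_translate: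
  assumes "(f \<longlongrightarrow> l) (sol_nhds (x - a))"
  shows "((\<lambda>y. f (y - a)) \<longlongrightarrow> l) (sol_nhds x)"
  unfolding tendsto_def
proof (intro allI impI)
  fix S
  assume "open S" "l \<in> S"
  then have "eventually (\<lambda>y. f y \<in> S) (sol_nhds (x - a))"
    using assms by (simp add: tendsto_def)
  then obtain e where e: "0 < e" "\<And>y. sol_norm (y - (x - a)) < e \<Longrightarrow> f y \<in> S"
    unfolding eventually_sol_nhds by blast
  have "f (y - a) \<in> S" if "sol_norm (y - x) < e" for y
    using that by (intro e(2)) simp
  with e(1) show "eventually (\<lambda>y. f (y - a) \<in> S) (sol_nhds x)"
    unfolding eventually_sol_nhds by blast
qed

text \<open>Norm balls contain the Euclidean balls of the same radius.\<close>

lemma isCont_if_tendsto_sol_nhds: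
  fixes f :: "real \<Rightarrow> real"
  assumes "(f \<longlongrightarrow> f x) (sol_nhds x)"
  shows "isCont f x"
  unfolding isCont_def tendsto_iff
proof (intro allI impI)
  fix e :: real
  assume "0 < e"
  with assms obtain d where d: "0 < d" "\<And>y. sol_norm (y - x) < d \<Longrightarrow> dist (f y) (f x) < e"
    unfolding tendsto_iff eventually_sol_nhds by blast
  have "dist (f y) (f x) < e" if "dist y x < d" for y
    using that sol_norm_le_abs [of "y - x"] by (intro d(2)) (simp add: dist_real_def)
  with d(1) show "\<forall>\<^sub>F y in at x. dist (f y) (f x) < e"
    unfolding eventually_at by blast
qed

section \<open>Disjoint bumps accumulating at 0 in the norm\<close>

text \<open>A tent around \<open>2 ^ k\<close> whose norm radius is a quarter of the separation in
  \<open>sol_norm_power_diff_ge\<close>.\<close>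

definition sol_bump :: "nat \<Rightarrow> real \<Rightarrow> real" where
  "sol_bump k x = max 0 (1 - 4 * 2 ^ k * sol_norm (x - 2 ^ k))"

text \<open>Decoding pairs makes every value \<open>1 / (1 + j)\<close> occur for infinitely many \<open>k\<close>.\<close>

definition bump_height :: "nat \<Rightarrow> real" where
  "bump_height k = 1 / (1 + real (fst (prod_decode k)))"

definition bump_sum :: "real \<Rightarrow> real" where
  "bump_sum x = (\<Sum>k. bump_height k * sol_bump k x)"

lemma sol_bump_eq_0_iff: "sol_bump k x = 0 \<longleftrightarrow> 1 / (4 * 2 ^ k) \<le> sol_norm (x - 2 ^ k)"
  by (auto simp: sol_bump_def max_def field_simps)

lemma sol_bump_bounds: "0 \<le> sol_bump k x" "sol_bump k x \<le> 1"
  by (auto simp: sol_bump_def)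

lemma bump_height_bounds: "0 < bump_height k" "bump_height k \<le> 1"
  by (auto simp: bump_height_def)

lemma bump_height_frequent: "\<exists>k\<ge>K. bump_height k = 1 / (1 + real j)"
  by (rule exI [of _ "prod_encode (j, K)"]) (simp add: bump_height_def le_prod_encode_2)

text \<open>If two of the balls met, their centres would be within \<open>1 / (2 * 2 ^ m)\<close>,
  with \<open>m\<close> the smaller exponent, against \<open>sol_norm_power_diff_ge\<close>. The
  closed ball includes the feet of the bump.\<close>

lemma sol_bump_disjoint:
  assumes "k \<noteq> l" "sol_norm (x - 2 ^ k) \<le> 1 / (4 * 2 ^ k)"
  shows "sol_bump l x = 0"
proof (rule ccontr)
  assume "sol_bump l x \<noteq> 0"
  then have l: "sol_norm (x - 2 ^ l) < 1 / (4 * 2 ^ l)"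
    by (simp add: sol_bump_eq_0_iff)
  have *: False if "m < n" "sol_norm (x - 2 ^ m) \<le> 1 / (4 * 2 ^ m)"
    "sol_norm (x - 2 ^ n) \<le> 1 / (4 * 2 ^ n)" for m n
  proof -
    have "(2 :: real) ^ m \<le> 2 ^ n"
      using that(1) by (intro power_increasing) auto
    then have "1 / (4 * 2 ^ n) \<le> 1 / (4 * 2 ^ m :: real)"
      by (intro divide_left_mono) auto
    moreover have "1 / 2 ^ m = 4 * (1 / (4 * 2 ^ m :: real))" "0 < 1 / (4 * 2 ^ m :: real)"
      by auto
    ultimately show False
      using that sol_norm_power_diff_ge [OF that(1)]
        sol_norm_triangle_diff [of "2 ^ m" "2 ^ n" x] sol_norm_commute [of x "2 ^ m"] by linarith
  qed
  show False
    using * [of k l] * [of l k] assms l by (cases k l rule: linorder_cases) auto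
qed

lemma bump_sum_eq:
  assumes "sol_norm (x - 2 ^ k) \<le> 1 / (4 * 2 ^ k)"
  shows "bump_sum x = bump_height k * sol_bump k x"
  unfolding bump_sum_def
  by (subst suminf_finite [where N = "{k}"]) (use sol_bump_disjoint [OF _ assms] in auto)

lemma bump_sum_cases:
  obtains "\<And>k. sol_bump k x = 0" "bump_sum x = 0"
  | k where "sol_norm (x - 2 ^ k) < 1 / (4 * 2 ^ k)" "bump_sum x = bump_height k * sol_bump k x"
proof (cases "\<forall>k. sol_bump k x = 0")
  case True
  then show ?thesis
    using that(1) by (simp add: bump_sum_def)
next
  case False
  then obtain k where "sol_norm (x - 2 ^ k) < 1 / (4 * 2 ^ k)"
    by (auto simp: sol_bump_eq_0_iff not_le)
  then show ?thesis
    using that(2) [of k] bump_sum_eq [of x k] by simp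
qed

lemma bump_sum_bounds: "0 \<le> bump_sum x" "bump_sum x \<le> 1"
proof -
  have "0 \<le> bump_sum x \<and> bump_sum x \<le> 1"
  proof (cases x rule: bump_sum_cases)
    case (2 k)
    then show ?thesis
      using sol_bump_bounds [of k x] bump_height_bounds [of k]
      by (auto intro: mult_le_one)
  qed auto
  then show "0 \<le> bump_sum x" "bump_sum x \<le> 1"
    by auto
qed

lemma bump_sum_eq_0:
  assumes "\<bar>x\<bar> \<le> 1 / 2"
  shows "bump_sum x = 0"
proof (cases x rule: bump_sum_cases)
  case (2 k)
  then show ?thesis
    using sol_norm_near_power [of x k] assms by simp
qed

text \<open>The supports shrink to 0 in the norm, so near any other point the series is a finite sum
  of continuous terms.\<close>

lemma tendsto_bump_sum:
  assumes "x \<noteq> 0"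
  shows "(bump_sum \<longlongrightarrow> bump_sum x) (sol_nhds x)"
proof -
  define r where "r = sol_norm x / 2"
  have r: "0 < r"
    using assms sol_norm_nonneg [of x] unfolding r_def by (simp add: less_le)
  \<comment> \<open>Bump \<open>k\<close> lives within norm \<open>2 / 2 ^ k\<close> of 0, hence the
    bumps from \<open>K\<close> on vanish wherever the norm is at least \<open>r\<close>.\<close>
  then obtain K where K: "2 / 2 ^ K < r"
    using ex_divide_power2_less by blast
  have eq: "bump_sum y = (\<Sum>k<K. bump_height k * sol_bump k y)" if y: "r \<le> sol_norm y" for y
  proof -
    have "sol_bump k y = 0" if "k \<notin> {..<K}" for k
    proof (rule ccontr)
      assume "sol_bump k y \<noteq> 0"
      then have "sol_norm (y - 2 ^ k) < 1 / (4 * 2 ^ k)"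
        by (simp add: sol_bump_eq_0_iff)
      also have "1 / (4 * 2 ^ k) \<le> 1 / (2 ^ k :: real)"
        by (simp add: field_simps)
      finally have "sol_norm y < 2 / 2 ^ k"
        using sol_norm_triangle_diff [of y 0 "2 ^ k"] sol_norm_power_le [of k] by simp
      also have "2 / 2 ^ k \<le> 2 / (2 ^ K :: real)"
        using that by (intro divide_left_mono power_increasing) auto
      finally show False
        using K y by simp
    qed
    then show ?thesis
      unfolding bump_sum_def by (intro suminf_finite) auto
  qed
  have "\<forall>\<^sub>F y in sol_nhds x. r \<le> sol_norm y"
    unfolding eventually_sol_nhds
  proof (intro exI conjI allI impI)
    fix y
    assume "sol_norm (y - x) < r"
    then show "r \<le> sol_norm y"
      using sol_norm_triangle_diff [of x 0 y] sol_norm_commute [of x y] by (simp add: r_def)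
  qed (fact r)
  then have "\<forall>\<^sub>F y in sol_nhds x. (\<Sum>k<K. bump_height k * sol_bump k y) = bump_sum y"
    by eventually_elim (simp add: eq)
  moreover have "((\<lambda>y. \<Sum>k<K. bump_height k * sol_bump k y)
      \<longlongrightarrow> (\<Sum>k<K. bump_height k * sol_bump k x)) (sol_nhds x)"
    unfolding sol_bump_def by (intro tendsto_intros tendsto_sol_norm)
  moreover have "(\<Sum>k<K. bump_height k * sol_bump k x) = bump_sum x"
    using r by (intro eq [symmetric]) (simp add: r_def)
  ultimately show ?thesis
    using tendsto_cong by fastforce
qed

text \<open>Norm continuity suffices away from 0; at 0 the sum is constant on a Euclidean
  neighbourhood, though on no norm neighbourhood.\<close>

lemma isCont_bump_sum: "isCont bump_sum x"
proof (cases "x = 0")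
  case True
  have "\<forall>\<^sub>F y in nhds 0. \<bar>y\<bar> < 1 / (2 :: real)"
    unfolding eventually_nhds_metric by (intro exI [of _ "1 / 2"]) auto
  then have "\<forall>\<^sub>F y in nhds 0. bump_sum y = 0"
    by eventually_elim (simp add: bump_sum_eq_0)
  then have "isCont bump_sum 0 \<longleftrightarrow> isCont (\<lambda>_. 0 :: real) (0 :: real)"
    by (intro isCont_cong)
  with True show ?thesis
    by simp
next
  case False
  then show ?thesis
    by (intro isCont_if_tendsto_sol_nhds tendsto_bump_sum)
qed

section \<open>Superposition of the bumps over a sequence of centres\<close>

lemma summable_half: "summable (\<lambda>i. 1 / 2 ^ i :: real)"
  using summable_geometric [of "1 / 2 :: real"] by (simp add: power_one_over)

text \<open>Tannery's theorem with a geometric majorant; it serves the Euclidean and the norm filter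
  alike.\<close>

lemma tendsto_suminf_half:
  fixes f :: "nat \<Rightarrow> 'a \<Rightarrow> real"
  assumes "\<And>i. (f i \<longlongrightarrow> l i) F" "\<And>i y. \<bar>f i y\<bar> \<le> 1 / 2 ^ i" "F \<noteq> bot"
  shows "((\<lambda>y. \<Sum>i. f i y) \<longlongrightarrow> (\<Sum>i. l i)) F"
proof -
  have "eventually (\<lambda>(i, y). norm (f i y) \<le> 1 / 2 ^ i) (at_top \<times>\<^sub>F F)"
    using assms(2) by (intro always_eventually) auto
  then show ?thesis
    using tannerys_theorem [of f l F "\<lambda>i. 1 / 2 ^ i"] assms summable_half by blast
qed

definition bumps_at :: "(nat \<Rightarrow> real) \<Rightarrow> real \<Rightarrow> real" where
  "bumps_at d x = (\<Sum>i. bump_sum (x - d i) / 2 ^ i)"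

lemma bump_sum_scaled_le: "\<bar>bump_sum x / 2 ^ i\<bar> \<le> 1 / 2 ^ i"
  using bump_sum_bounds [of x] by (simp add: divide_right_mono)

lemma continuous_bumps_at: "continuous_on UNIV (bumps_at d)"
proof -
  have "isCont (\<lambda>x. bump_sum (x - d i)) x" for i x
    by (rule isCont_o2 [where f = "\<lambda>x. x - d i" and g = bump_sum]) (auto intro: isCont_bump_sum)
  then have "((\<lambda>y. bump_sum (y - d i) / 2 ^ i) \<longlongrightarrow> bump_sum (x - d i) / 2 ^ i) (at x)" for i x
    by (intro tendsto_intros) (auto simp: isCont_def)
  then have "isCont (bumps_at d) x" for x
    unfolding isCont_def bumps_at_def
    by (intro tendsto_suminf_half bump_sum_scaled_le) auto
  then show ?thesis
    by (simp add: continuous_at_imp_continuous_on)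
qed

lemma tendsto_bumps_at:
  assumes "x \<notin> range d"
  shows "(bumps_at d \<longlongrightarrow> bumps_at d x) (sol_nhds x)"
proof -
  have "((\<lambda>y. bump_sum (y - d i)) \<longlongrightarrow> bump_sum (x - d i)) (sol_nhds x)" for i
    using assms by (intro tendsto_sol_nhds_translate tendsto_bump_sum) auto
  then show ?thesis
    unfolding bumps_at_def
    by (intro tendsto_suminf_half bump_sum_scaled_le tendsto_intros) auto
qed

text \<open>As \<open>d\<close> is injective, only the \<open>k\<close>-th summand is centred at
  \<open>d k\<close>; without it the series is norm continuous there.\<close>

lemma tendsto_bumps_at_remainder:
  fixes d :: "nat \<Rightarrow> real" and k :: nat
  assumes "inj d"
  defines "r \<equiv> \<lambda>y. bumps_at d y - bump_sum (y - d k) / 2 ^ k"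
  shows "(r \<longlongrightarrow> r (d k)) (sol_nhds (d k))"
proof -
  \<comment> \<open>Writing \<open>r\<close> as a series with its \<open>k\<close>-th term zeroed
    makes the termwise limit applicable.\<close>
  have r: "r y = (\<Sum>i. if i = k then 0 else bump_sum (y - d i) / 2 ^ i)" for y
  proof -
    have "summable (\<lambda>i. bump_sum (y - d i) / 2 ^ i)"
      by (rule summable_comparison_test' [OF summable_half]) (use bump_sum_scaled_le in auto)
    then have "bumps_at d y - (\<Sum>i. if i = k then bump_sum (y - d k) / 2 ^ k else 0)
        = (\<Sum>i. bump_sum (y - d i) / 2 ^ i - (if i = k then bump_sum (y - d k) / 2 ^ k else 0))"
      unfolding bumps_at_def
      by (intro suminf_diff) (auto intro: summable_finite [of "{k}"])
    also have "(\<Sum>i. if i = k then bump_sum (y - d k) / 2 ^ k else 0) = bump_sum (y - d k) / 2 ^ k"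
      by (subst suminf_finite [of "{k}"]) auto
    finally show ?thesis
      unfolding r_def by (auto intro!: arg_cong [where f = suminf])
  qed
  have "((\<lambda>y. if i = k then 0 else bump_sum (y - d i) / 2 ^ i)
      \<longlongrightarrow> (if i = k then 0 else bump_sum (d k - d i) / 2 ^ i)) (sol_nhds (d k))" for i
  proof (cases "i = k")
    case False
    with assms(1) have "d k - d i \<noteq> 0"
      by (auto dest: injD)
    then have "((\<lambda>y. bump_sum (y - d i)) \<longlongrightarrow> bump_sum (d k - d i)) (sol_nhds (d k))"
      by (intro tendsto_sol_nhds_translate tendsto_bump_sum)
    with False show ?thesis
      by (simp add: tendsto_divide)
  qed simp
  then show ?thesis
    unfolding r by (intro tendsto_suminf_half) (use bump_sum_scaled_le in auto)
qed

section \<open>Recognising the bump centres\<close>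

text \<open>Among segments inside a fixed \<open>W\<close>, those with ends near \<open>x\<close>
  stay near \<open>x\<close>. Only open sets and segments are mentioned, so homeomorphisms that are
  also Euclidean continuous carry the property along.\<close>

definition segment_regular :: "real topology \<Rightarrow> real \<Rightarrow> bool" where
  "segment_regular T x \<longleftrightarrow>
     (\<exists>W. openin T W \<and> x \<in> W \<and>
       (\<forall>U. openin T U \<and> x \<in> U \<longrightarrow>
         (\<exists>V. openin T V \<and> x \<in> V \<and>
           (\<forall>y\<in>V. \<forall>z\<in>V. closed_segment y z \<subseteq> W \<longrightarrow> closed_segment y z \<subseteq> U))))"

text \<open>A continuous injection of the line maps segments onto segments; \<open>W\<close> and
  \<open>V\<close> are pushed forward by \<open>h\<close>, the test sets \<open>U\<close> are pulled
  back.\<close>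

lemma segment_regular_homeomorphic_image:
  assumes h: "homeomorphic_map S T h" and top: "topspace S = UNIV" "topspace T = UNIV"
    and cont: "continuous_on UNIV h" and reg: "segment_regular S x"
  shows "segment_regular T (h x)"
proof -
  have inj: "inj h"
    using homeomorphic_imp_injective_map [OF h] top by simp
  have seg: "h ` closed_segment y z = closed_segment (h y) (h z)" for y z
    using cont inj
    by (intro continuous_injective_image_segment_1) (auto intro: continuous_on_subset inj_on_subset)
  have op: "openin T (h ` A)" if "openin S A" for A
    using homeomorphic_imp_open_map [OF h] that by (simp add: open_map_def)
  have pre: "openin S (h -` A)" if "openin T A" for A
    using openin_continuous_map_preimage [OF homeomorphic_imp_continuous_map [OF h] that] top
    by (simp add: vimage_def)
  from reg obtain W where W: "openin S W" "x \<in> W"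
    and W_U: "\<And>U. openin S U \<Longrightarrow> x \<in> U \<Longrightarrow> \<exists>V. openin S V \<and> x \<in> V \<and>
      (\<forall>y\<in>V. \<forall>z\<in>V. closed_segment y z \<subseteq> W \<longrightarrow> closed_segment y z \<subseteq> U)"
    unfolding segment_regular_def by blast
  show ?thesis
    unfolding segment_regular_def
  proof (rule exI [of _ "h ` W"], intro conjI allI impI)
    show "openin T (h ` W)" "h x \<in> h ` W"
      using W op by auto
    fix U
    assume U: "openin T U \<and> h x \<in> U"
    then obtain V where V: "openin S V" "x \<in> V"
      and VU: "\<And>y z. y \<in> V \<Longrightarrow> z \<in> V \<Longrightarrow> closed_segment y z \<subseteq> W \<Longrightarrow> closed_segment y z \<subseteq> h -` U"
      using W_U [of "h -` U"] pre by auto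
    show "\<exists>V. openin T V \<and> h x \<in> V \<and>
      (\<forall>y\<in>V. \<forall>z\<in>V. closed_segment y z \<subseteq> h ` W \<longrightarrow> closed_segment y z \<subseteq> U)"
    proof (rule exI [of _ "h ` V"], intro conjI)
      show "openin T (h ` V)" "h x \<in> h ` V"
        using V op by auto
      show "\<forall>y\<in>h ` V. \<forall>z\<in>h ` V. closed_segment y z \<subseteq> h ` W \<longrightarrow> closed_segment y z \<subseteq> U"
      proof clarify
        fix y z w
        assume yz: "y \<in> V" "z \<in> V" and sub: "closed_segment (h y) (h z) \<subseteq> h ` W"
          and w: "w \<in> closed_segment (h y) (h z)"
        from sub have "closed_segment y z \<subseteq> W"
          unfolding seg [symmetric] by (simp add: inj_image_subset_iff [OF inj])
        then have "closed_segment y z \<subseteq> h -` U"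
          by (rule VU [OF yz])
        with w show "w \<in> U"
          unfolding seg [symmetric] by auto
      qed
    qed
  qed
qed

text \<open>A segment between two different sheets contains some \<open>x + m + 1 / 2\<close> with \<open>m\<close> an integer.\<close>

lemma segment_subset_sol_ball:
  assumes y: "sol_norm (y - x) < e" and z: "sol_norm (z - x) < e" and e: "e \<le> 1 / 4"
    and sub: "closed_segment y z \<subseteq> {w. sol_norm (w - x) < 1 / 4}"
  shows "closed_segment y z \<subseteq> {w. sol_norm (w - x) < e}"
proof -
  have *: "closed_segment y z \<subseteq> {w. sol_norm (w - x) < e}"
    if y: "sol_norm (y - x) < e" and z: "sol_norm (z - x) < e"
    and sub: "closed_segment y z \<subseteq> {w. sol_norm (w - x) < 1 / 4}" and "y \<le> z" for y z
  proof -
    obtain n i where ni: "\<bar>y - x - 2 ^ n * real_of_int i\<bar> + 1 / 2 ^ n < e"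
      using y by (rule sol_norm_lessE)
    obtain m j where mj: "\<bar>z - x - 2 ^ m * real_of_int j\<bar> + 1 / 2 ^ m < e"
      using z by (rule sol_norm_lessE)
    define a b where "a = 2 ^ n * i" and "b = 2 ^ m * j"
    have ra: "real_of_int a = 2 ^ n * real_of_int i" and rb: "real_of_int b = 2 ^ m * real_of_int j"
      by (simp_all add: a_def b_def)
    have pos: "0 < 1 / (2 ^ n :: real)" "0 < 1 / (2 ^ m :: real)"
      by simp_all
    have "a \<le> b"
    proof (rule ccontr)
      assume "\<not> a \<le> b"
      then have "real_of_int b + 1 \<le> real_of_int a"
        by linarith
      with ni mj ra rb e pos \<open>y \<le> z\<close> show False
        by linarith
    qed
    have "\<not> a < b"
    proof
      assume "a < b"
      then have "real_of_int a + 1 \<le> real_of_int b"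
        by linarith
      then have "y \<le> x + real_of_int a + 1 / 2" "x + real_of_int a + 1 / 2 \<le> z"
        using ni mj ra rb e pos by linarith+
      then have "x + real_of_int a + 1 / 2 \<in> closed_segment y z"
        using closed_segment_eq_real_ivl1 [OF \<open>y \<le> z\<close>] by simp
      with sub have "sol_norm (real_of_int a + 1 / 2) < 1 / 4"
        by (auto simp: algebra_simps)
      then obtain p q where pq:
          "\<bar>real_of_int a + 1 / 2 - 2 ^ p * real_of_int q\<bar> + 1 / 2 ^ p < 1 / 4"
        by (rule sol_norm_lessE)
      have "0 < 1 / (2 ^ p :: real)"
        by simp
      with pq have lt: "\<bar>real_of_int a + 1 / 2 - 2 ^ p * real_of_int q\<bar> < 1 / 4"
        by linarith
      have "real_of_int (a - 2 ^ p * q) = real_of_int a - 2 ^ p * real_of_int q"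
        by simp
      \<comment> \<open>No integer lies within 1/4 of -1/2.\<close>
      with lt have "- 1 < real_of_int (a - 2 ^ p * q)" "real_of_int (a - 2 ^ p * q) < 0"
        by linarith+
      then have "- 1 < a - 2 ^ p * q" "a - 2 ^ p * q < 0"
        by linarith+
      then show False
        by linarith
    qed
    with \<open>a \<le> b\<close> have "a = b"
      by simp
    show ?thesis
    proof
      fix w
      assume "w \<in> closed_segment y z"
      then have w: "y \<le> w" "w \<le> z"
        using closed_segment_eq_real_ivl1 [OF \<open>y \<le> z\<close>] by auto
      \<comment> \<open>Both ends lie on one sheet, and the distance of \<open>w\<close> from its
        centre is at most that of one of the ends; the bound with the price of that end
        applies.\<close>
      have "sol_norm (w - x) \<le> \<bar>w - x - 2 ^ n * real_of_int i\<bar> + 1 / 2 ^ n"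
        "sol_norm (w - x) \<le> \<bar>w - x - 2 ^ m * real_of_int j\<bar> + 1 / 2 ^ m"
        by (rule sol_norm_le)+
      then show "w \<in> {w. sol_norm (w - x) < e}"
        using ni mj w \<open>a = b\<close> ra rb by (smt (verit) mem_Collect_eq)
    qed
  qed
  show ?thesis
  proof (cases "y \<le> z")
    case True
    then show ?thesis
      using * y z sub by blast
  next
    case False
    then show ?thesis
      using * [OF z y] sub by (simp add: closed_segment_commute)
  qed
qed

text \<open>If \<open>g\<close> is norm continuous at \<open>x\<close>, norm balls form a base of
  neighbourhoods of \<open>x\<close> in the refined topology too, and
  \<open>segment_subset_sol_ball\<close> applies.\<close>

lemma segment_regular_if_tendsto:
  assumes g: "(g \<longlongrightarrow> g x) (sol_nhds x)"
  shows "segment_regular (refined_topology g) x"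
  unfolding segment_regular_def
proof (rule exI [of _ "{w. sol_norm (w - x) < 1 / 4}"], intro conjI allI impI)
  show "openin (refined_topology g) {w. sol_norm (w - x) < 1 / 4}"
    by (rule openin_refined_sol_ball)
  show "x \<in> {w. sol_norm (w - x) < 1 / 4}"
    by simp
  fix U
  assume "openin (refined_topology g) U \<and> x \<in> U"
  then obtain r where r: "0 < r" "\<And>y. sol_norm (y - x) + \<bar>g y - g x\<bar> < r \<Longrightarrow> y \<in> U"
    unfolding openin_refined by blast
  from g r(1) obtain s where s: "0 < s" "\<And>y. sol_norm (y - x) < s \<Longrightarrow> dist (g y) (g x) < r / 2"
    unfolding tendsto_iff eventually_sol_nhds by (meson half_gt_zero)
  define e where "e = min (min s (r / 2)) (1 / 4)"
  have e: "0 < e" "e \<le> 1 / 4" "e \<le> s" "e \<le> r / 2"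
    using r s by (auto simp: e_def)
  have U: "{w. sol_norm (w - x) < e} \<subseteq> U"
  proof clarify
    fix w
    assume "sol_norm (w - x) < e"
    then show "w \<in> U"
      using e s(2) [of w] by (intro r(2)) (simp add: dist_real_def)
  qed
  show "\<exists>V. openin (refined_topology g) V \<and> x \<in> V \<and>
      (\<forall>y\<in>V. \<forall>z\<in>V. closed_segment y z \<subseteq> {w. sol_norm (w - x) < 1 / 4}
        \<longrightarrow> closed_segment y z \<subseteq> U)"
  proof (rule exI [of _ "{w. sol_norm (w - x) < e}"], intro conjI ballI impI)
    show "openin (refined_topology g) {w. sol_norm (w - x) < e}"
      by (rule openin_refined_sol_ball)
    show "x \<in> {w. sol_norm (w - x) < e}"
      using e by simp
    fix y z
    assume "y \<in> {w. sol_norm (w - x) < e}" "z \<in> {w. sol_norm (w - x) < e}"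
      "closed_segment y z \<subseteq> {w. sol_norm (w - x) < 1 / 4}"
    then show "closed_segment y z \<subseteq> U"
      using segment_subset_sol_ball [of y x e z] e U by blast
  qed
qed

text \<open>Bumps of every height \<open>1 / (1 + j)\<close> accumulate at \<open>d k\<close>, so every neighbourhood \<open>W\<close>
  swallows the segments crossing sufficiently low bumps, while a smaller neighbourhood
  contains the feet but not the tops of these bumps.\<close>

lemma not_segment_regular_bumps_at:
  assumes "inj d"
  shows "\<not> segment_regular (refined_topology (bumps_at d)) (d k)"
proof
  let ?g = "bumps_at d"
  let ?D = "\<lambda>y. sol_norm (y - d k) + \<bar>?g y - ?g (d k)\<bar>"
  assume "segment_regular (refined_topology ?g) (d k)"
  then obtain W where W: "openin (refined_topology ?g) W" "d k \<in> W"
    and W_U: "\<And>U. openin (refined_topology ?g) U \<Longrightarrow> d k \<in> U \<Longrightarrow>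
      \<exists>V. openin (refined_topology ?g) V \<and> d k \<in> V \<and>
      (\<forall>y\<in>V. \<forall>z\<in>V. closed_segment y z \<subseteq> W \<longrightarrow> closed_segment y z \<subseteq> U)"
    unfolding segment_regular_def by blast
  from W obtain e where e: "0 < e" "\<And>y. ?D y < e \<Longrightarrow> y \<in> W"
    unfolding openin_refined by blast
  define r where "r = (\<lambda>y. ?g y - bump_sum (y - d k) / 2 ^ k)"
  have r: "(r \<longlongrightarrow> r (d k)) (sol_nhds (d k))"
    unfolding r_def by (rule tendsto_bumps_at_remainder [OF assms])
  have g: "?g y - ?g (d k) = bump_sum (y - d k) / 2 ^ k + (r y - r (d k))" for y
    using bump_sum_eq_0 [of 0] by (simp add: r_def)
  obtain j where "1 / (1 + real j) < e / 3"
    using e(1) reals_Archimedean [of "e / 3"] by (auto simp: inverse_eq_divide)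
  define a where "a = 1 / (1 + real j)"
  \<comment> \<open>The weighted height of the chosen bumps: below \<open>e / 3\<close>, so that
    they fit into \<open>W\<close>, while the radius \<open>c / 2\<close> of \<open>U\<close>
    excludes their tops.\<close>
  define c where "c = a / 2 ^ k"
  have "0 < a"
    by (simp add: a_def)
  then have "0 < c"
    by (simp add: c_def)
  have "c \<le> a"
    using \<open>0 < a\<close> by (simp add: c_def field_simps)
  then have "c < e / 3"
    using \<open>1 / (1 + real j) < e / 3\<close> a_def by linarith
  define U where "U = {y. ?D y < c / 2}"
  have "openin (refined_topology ?g) U"
    unfolding U_def by (rule openin_refined_ball)
  moreover have "d k \<in> U"
    using \<open>0 < c\<close> by (simp add: U_def)
  ultimately obtain V where V: "openin (refined_topology ?g) V" "d k \<in> V"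
    and VU: "\<And>y z. y \<in> V \<Longrightarrow> z \<in> V \<Longrightarrow> closed_segment y z \<subseteq> W \<Longrightarrow> closed_segment y z \<subseteq> U"
    using W_U by meson
  from V obtain e' where e': "0 < e'" "\<And>y. ?D y < e' \<Longrightarrow> y \<in> V"
    unfolding openin_refined by blast
  \<comment> \<open>A common bound for norm and remainder: \<open>e / 3\<close> keeps the segment in
    \<open>W\<close>, \<open>e' / 2\<close> puts the feet into \<open>V\<close>, and
    \<open>c / 2\<close> stops the remainder from cancelling the top.\<close>
  define s where "s = min (min (e / 3) (e' / 2)) (c / 2)"
  have s: "0 < s" "s \<le> e / 3" "s \<le> e' / 2" "s \<le> c / 2"
    using \<open>0 < c\<close> e(1) e'(1) by (auto simp: s_def)
  from r s(1) obtain t where t: "0 < t" "\<And>y. sol_norm (y - d k) < t \<Longrightarrow> dist (r y) (r (d k)) < s"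
    unfolding tendsto_iff eventually_sol_nhds by blast
  obtain K where K: "2 / 2 ^ K < min s t"
    using ex_divide_power2_less [of "min s t" 2] s t by auto
  obtain l where l: "K \<le> l" "bump_height l = a"
    using bump_height_frequent unfolding a_def by blast
  \<comment> \<open>The radius of bump \<open>l\<close>, so the segment below runs from foot to
    foot; since it is at most 1/4, \<open>sol_norm_eq_abs\<close> gives the feet norm distance
    exactly \<open>q\<close> from the centre.\<close>
  define q where "q = 1 / (4 * 2 ^ l :: real)"
  have q: "0 < q" "q \<le> 1 / 4" "q \<le> 1 / 2 ^ l"
    by (auto simp: q_def field_simps)
  have "2 / 2 ^ l \<le> 2 / (2 ^ K :: real)"
    using l by (intro divide_left_mono power_increasing) auto
  with K have l_small: "2 / 2 ^ l < s" "2 / 2 ^ l < t"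
    by simp_all
  let ?p = "d k + 2 ^ l"
  have near: "sol_norm (w - d k) < s" "\<bar>r w - r (d k)\<bar> < s" "sol_norm (w - d k - 2 ^ l) \<le> q"
    if w: "w \<in> closed_segment (?p - q) (?p + q)" for w
  proof -
    have "\<bar>w - d k - 2 ^ l\<bar> \<le> q"
      using w q(1) by (simp add: closed_segment_eq_real_ivl abs_le_iff)
    then show q': "sol_norm (w - d k - 2 ^ l) \<le> q"
      using sol_norm_le_abs [of "w - d k - 2 ^ l"] by simp
    have "sol_norm (w - d k) \<le> q + 1 / 2 ^ l"
      using sol_norm_triangle [of "w - d k - 2 ^ l" "2 ^ l"] sol_norm_power_le [of l] q' by simp
    with q l_small have "sol_norm (w - d k) < s" "sol_norm (w - d k) < t"
      by simp_all
    then show "sol_norm (w - d k) < s" "\<bar>r w - r (d k)\<bar> < s"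
      using t(2) [of w] by (simp_all add: dist_real_def)
  qed
  have sum: "bump_sum (w - d k) = a * sol_bump l (w - d k)"
    if "w \<in> closed_segment (?p - q) (?p + q)" for w
    using bump_sum_eq [of "w - d k" l] near(3) [OF that] l(2) by (simp add: q_def)
  have "closed_segment (?p - q) (?p + q) \<subseteq> W"
  proof
    fix w
    assume w: "w \<in> closed_segment (?p - q) (?p + q)"
    have "0 \<le> bump_sum (w - d k)" "bump_sum (w - d k) \<le> a"
      using sum [OF w] sol_bump_bounds [of l "w - d k"] \<open>0 < a\<close> by (auto simp: mult_left_le)
    then have "0 \<le> bump_sum (w - d k) / 2 ^ k" "bump_sum (w - d k) / 2 ^ k \<le> c"
      by (simp_all add: c_def divide_right_mono)
    then have "?D w < e"
      using near [OF w] g [of w] s(2) \<open>c < e / 3\<close> by linarith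
    then show "w \<in> W"
      by (rule e(2))
  qed
  moreover have "w \<in> V" if "w \<in> {?p - q, ?p + q}" for w
  proof -
    have w: "w \<in> closed_segment (?p - q) (?p + q)"
      using that by auto
    have "\<bar>w - d k - 2 ^ l\<bar> = q"
      using that q(1) by auto
    then have "sol_norm (w - d k - 2 ^ l) = q"
      using sol_norm_eq_abs [of "w - d k - 2 ^ l"] q(2) by simp
    then have "sol_bump l (w - d k) = 0"
      by (simp add: sol_bump_eq_0_iff q_def)
    then have "bump_sum (w - d k) = 0"
      using sum [OF w] by simp
    then have "?D w < e'"
      using near [OF w] g [of w] s(3) by simp
    then show ?thesis
      by (rule e'(2))
  qed
  ultimately have "closed_segment (?p - q) (?p + q) \<subseteq> U"
    by (intro VU) auto
  moreover have p: "?p \<in> closed_segment (?p - q) (?p + q)"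
    using q(1) by (simp add: closed_segment_eq_real_ivl)
  ultimately have "?D ?p < c / 2"
    by (auto simp: U_def)
  moreover have "bump_sum (?p - d k) / 2 ^ k = c"
    using sum [OF p] by (simp add: sol_bump_def c_def)
  ultimately show False
    using near(2) [OF p] g [of ?p] s(4) sol_norm_nonneg [of "?p - d k"] by linarith
qed

lemma segment_regular_bumps_at_iff:
  assumes "inj d"
  shows "segment_regular (refined_topology (bumps_at d)) x \<longleftrightarrow> x \<notin> range d"
  using not_segment_regular_bumps_at [OF assms]
    segment_regular_if_tendsto [OF tendsto_bumps_at] by blast

section \<open>Membership in \<open>L_topologies\<close> and first category\<close>

lemma refined_topology_in_L:
  assumes "continuous_on UNIV g"
  shows "refined_topology g \<in> L_topologies"
  using assms by (auto simp: L_topologies_def Hausdorff_refined intro: open_if_openin_refined)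

text \<open>Compactness passes to the coarser topology, which is Hausdorff.\<close>

lemma closedin_refined_compact:
  assumes "continuous_on UNIV g" "compact K"
  shows "closedin (refined_topology g) K"
proof (rule compactin_imp_closedin [OF Hausdorff_refined])
  have "continuous_map euclidean (refined_topology g) id"
    by (auto simp: continuous_map_def open_if_openin_refined [OF assms(1)])
  then have "compactin (refined_topology g) (id ` K)"
    by (rule image_compactin [rotated]) (use assms in simp)
  then show "compactin (refined_topology g) K"
    by simp
qed

text \<open>Every nonempty open set contains a point \<open>x\<close> outside \<open>D\<close>, and there the points \<open>x + 2 ^ n\<close>
  converge to \<open>x\<close>, so a compact interval cannot have interior points.\<close>

lemma first_category_refined:
  assumes g: "continuous_on UNIV g"
    and D: "countable D" "\<And>x. x \<notin> D \<Longrightarrow> (g \<longlongrightarrow> g x) (sol_nhds x)"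
  shows "first_category_space (refined_topology g)"
  unfolding first_category_space_def
proof (intro exI [of _ "range (\<lambda>n. {- real n..real n})"] conjI ballI)
  let ?T = "refined_topology g"
  show "countable (range (\<lambda>n. {- real n..real n}))"
    by simp
  show "\<Union> (range (\<lambda>n. {- real n..real n})) = topspace ?T"
  proof -
    have "\<exists>n. x \<in> {- real n..real n}" for x :: real
      using real_arch_simple [of "\<bar>x\<bar>"] by (metis abs_le_iff atLeastAtMost_iff minus_le_iff)
    then show ?thesis
      by auto
  qed
  fix S
  assume "S \<in> range (\<lambda>n. {- real n..real n})"
  then obtain N where S: "S = {- real N..real N}"
    by blast
  have "closedin ?T S"
    unfolding S by (intro closedin_refined_compact g) simp
  have "?T interior_of S = {}"
  proof (rule ccontr)
    let ?I = "?T interior_of S"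
    assume "?I \<noteq> {}"
    moreover have "open ?I"
      by (rule open_if_openin_refined [OF g]) simp
    ultimately obtain x where x: "x \<in> ?I" "x \<notin> D"
      using open_minus_countable [OF D(1)] by blast
    have "openin ?T ?I"
      by simp
    with x(1) obtain e where e: "0 < e" "\<And>y. sol_norm (y - x) + \<bar>g y - g x\<bar> < e \<Longrightarrow> y \<in> ?I"
      unfolding openin_refined by blast
    from D(2) [OF x(2)] e(1)
    obtain t where t: "0 < t" "\<And>y. sol_norm (y - x) < t \<Longrightarrow> dist (g y) (g x) < e / 2"
      unfolding tendsto_iff eventually_sol_nhds by (meson half_gt_zero)
    \<comment> \<open>The first two bounds put \<open>x + 2 ^ m\<close> into the given ball around
      \<open>x\<close>; the third makes \<open>2 ^ m\<close> exceed the length \<open>2 * N\<close>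
      of \<open>S\<close>.\<close>
    obtain m where m: "1 / 2 ^ m < min (min t (e / 2)) (1 / (2 * real N + 1))"
      using ex_divide_power2_less [of "min (min t (e / 2)) (1 / (2 * real N + 1))" 1] t e by auto
    then have "1 / 2 ^ m < t" "1 / 2 ^ m < e / 2" "1 / 2 ^ m < 1 / (2 * real N + 1)"
      by simp_all
    then have "sol_norm (x + 2 ^ m - x) + \<bar>g (x + 2 ^ m) - g x\<bar> < e"
      using t(2) [of "x + 2 ^ m"] sol_norm_power_le [of m] by (simp add: dist_real_def)
    then have "x + 2 ^ m \<in> ?I"
      by (rule e(2))
    then have "x + 2 ^ m \<in> S" "x \<in> S"
      using x interior_of_subset by fast+
    moreover have "2 * real N + 1 < 2 ^ m"
      using \<open>1 / 2 ^ m < 1 / (2 * real N + 1)\<close> by (simp add: divide_less_eq less_divide_eq split: if_splits)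
    ultimately show False
      unfolding S by auto
  qed
  then show "nowhere_dense_in ?T S"
    using \<open>closedin ?T S\<close> by (simp add: nowhere_dense_in_def closure_of_closedin)
qed

section \<open>Encoding sets of natural numbers\<close>

text \<open>An invariant of the order type of \<open>D\<close> in the line; unordered segments make
  it blind to reversal.\<close>

definition gap_numbers :: "real set \<Rightarrow> nat set" where
  "gap_numbers D = {n. \<exists>u v. u \<noteq> v \<and> u islimpt D \<and> v islimpt D \<and>
     finite (D \<inter> open_segment u v) \<and> card (D \<inter> open_segment u v) = n}"

text \<open>Both open segments and limit points are carried along by a continuous injection of the
  line.\<close>

lemma gap_numbers_image_subset:
  assumes h: "continuous_on UNIV h" "inj h"
  shows "gap_numbers D \<subseteq> gap_numbers (h ` D)"
proof
  fix n
  assume "n \<in> gap_numbers D"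
  then obtain u v where uv: "u \<noteq> v" "u islimpt D" "v islimpt D" "finite (D \<inter> open_segment u v)"
      "card (D \<inter> open_segment u v) = n"
    unfolding gap_numbers_def by blast
  have "h ` open_segment u v = open_segment (h u) (h v)"
    using h by (intro continuous_injective_image_open_segment_1)
      (auto intro: continuous_on_subset inj_on_subset)
  then have eq: "h ` D \<inter> open_segment (h u) (h v) = h ` (D \<inter> open_segment u v)"
    using image_Int [OF h(2)] by blast
  have "h x islimpt h ` D" if "x islimpt D" for x
  proof (rule islimpt_isCont_image [OF that])
    show "isCont h x"
      using h(1) by (simp add: continuous_on_eq_continuous_at)
    show "\<forall>\<^sub>F y in at x. h y \<noteq> h x"
      using h(2) unfolding eventually_at by (auto dest: injD intro: exI [of _ 1])
  qed
  then have "h u \<noteq> h v \<and> h u islimpt h ` D \<and> h v islimpt h ` D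
      \<and> finite (h ` D \<inter> open_segment (h u) (h v)) \<and> card (h ` D \<inter> open_segment (h u) (h v)) = n"
    using uv h(2) unfolding eq by (auto simp: card_image inj_on_subset dest: injD)
  then show "n \<in> gap_numbers (h ` D)"
    unfolding gap_numbers_def by blast
qed

text \<open>The rationals with the intervals \<open>(2 n, 2 n + 1)\<close>, \<open>n \<in> A\<close>, thinned out to exactly \<open>n\<close> points.\<close>

definition gap_set :: "nat set \<Rightarrow> real set" where
  "gap_set A = (\<rat> - (\<Union>n\<in>A. {2 * real n<..<2 * real n + 1})) \<union>
     (\<Union>n\<in>A. (\<lambda>j. 2 * real n + 1 / (2 + real j)) ` {..<n})"

text \<open>The offset 2 keeps even the point for \<open>j = 0\<close> off the right end.\<close>

lemma gap_point: "2 * real n + 1 / (2 + real j) \<in> {2 * real n<..<2 * real n + 1}"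
  by (simp add: field_simps)

lemma gap_unique:
  assumes "x \<in> {2 * real n<..<2 * real n + 1}" "x \<in> {2 * real m..2 * real m + 1}"
  shows "n = m"
  using assms by auto

lemma gap_set_Int_gap:
  assumes "n \<in> A"
  shows "gap_set A \<inter> {2 * real n<..<2 * real n + 1} = (\<lambda>j. 2 * real n + 1 / (2 + real j)) ` {..<n}"
proof
  show "(\<lambda>j. 2 * real n + 1 / (2 + real j)) ` {..<n} \<subseteq> gap_set A \<inter> {2 * real n<..<2 * real n + 1}"
    using assms gap_point unfolding gap_set_def by fast
  show "gap_set A \<inter> {2 * real n<..<2 * real n + 1} \<subseteq> (\<lambda>j. 2 * real n + 1 / (2 + real j)) ` {..<n}"
  proof
    fix x
    assume x: "x \<in> gap_set A \<inter> {2 * real n<..<2 * real n + 1}"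
    then obtain m j where mj: "m \<in> A" "j < m" "x = 2 * real m + 1 / (2 + real j)"
      using assms unfolding gap_set_def by auto
    then have "x \<in> {2 * real m<..<2 * real m + 1}"
      using gap_point by blast
    then have "m = n"
      using x gap_unique [of x m n] by auto
    with mj show "x \<in> (\<lambda>j. 2 * real n + 1 / (2 + real j)) ` {..<n}"
      by auto
  qed
qed

lemma finite_gap_set_Int_gap: "n \<in> A \<Longrightarrow> finite (gap_set A \<inter> {2 * real n<..<2 * real n + 1})"
  by (simp add: gap_set_Int_gap)

lemma card_gap_set_Int_gap:
  assumes "n \<in> A"
  shows "card (gap_set A \<inter> {2 * real n<..<2 * real n + 1}) = n"
proof -
  have "inj_on (\<lambda>j. 2 * real n + 1 / (2 + real j)) {..<n}"
    by (rule inj_onI) (simp add: field_simps)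
  then show ?thesis
    using assms by (simp add: gap_set_Int_gap card_image)
qed

lemma infinite_Rats_Int_greaterThanLessThan:
  assumes "a < (b :: real)"
  shows "infinite (\<rat> \<inter> {a<..<b})"
proof
  assume fin: "finite (\<rat> \<inter> {a<..<b})"
  obtain q where "q \<in> \<rat>" "a < q" "q < b"
    using Rats_dense_in_real [OF assms] by blast
  let ?m = "Min (\<rat> \<inter> {a<..<b})"
  have m: "?m \<in> \<rat> \<inter> {a<..<b}"
    using \<open>q \<in> \<rat>\<close> \<open>a < q\<close> \<open>q < b\<close> fin by (intro Min_in) auto
  then obtain p where p: "p \<in> \<rat>" "a < p" "p < ?m"
    using Rats_dense_in_real [of a ?m] by auto
  with m have "p \<in> \<rat> \<inter> {a<..<b}"
    unfolding Int_iff greaterThanLessThan_iff by (blast intro: less_trans)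
  with p(3) show False
    using Min_le [OF fin] by (simp add: leD)
qed

lemma infinite_gap_set_Int:
  assumes "a < b" "\<And>n. n \<in> A \<Longrightarrow> {a<..<b} \<inter> {2 * real n<..<2 * real n + 1} = {}"
  shows "infinite (gap_set A \<inter> {a<..<b})"
proof -
  have "\<rat> \<inter> {a<..<b} \<subseteq> gap_set A \<inter> {a<..<b}"
    using assms(2) unfolding gap_set_def by blast
  then show ?thesis
    using infinite_Rats_Int_greaterThanLessThan [OF assms(1)] infinite_super by blast
qed

text \<open>The unit interval to the left of \<open>2 * n\<close> meets no thinned interval and
  keeps all its rationals.\<close>

lemma infinite_gap_set_below:
  assumes "a < 2 * real n"
  shows "infinite (gap_set A \<inter> {a<..<2 * real n})"
proof -
  have "infinite (gap_set A \<inter> {max a (2 * real n - 1)<..<2 * real n})"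
  proof (rule infinite_gap_set_Int)
    fix m
    have "real (m + 1) \<le> real n \<or> real n \<le> real m"
      unfolding of_nat_le_iff by linarith
    then show "{max a (2 * real n - 1)<..<2 * real n} \<inter> {2 * real m<..<2 * real m + 1} = {}"
      by auto
  qed (use assms in auto)
  then show ?thesis
    by (rule contrapos_nn) (auto elim!: finite_subset [rotated])
qed

lemma infinite_gap_set_above:
  assumes "2 * real n + 1 < b"
  shows "infinite (gap_set A \<inter> {2 * real n + 1<..<b})"
proof -
  have "infinite (gap_set A \<inter> {2 * real n + 1<..<min b (2 * real n + 2)})"
  proof (rule infinite_gap_set_Int)
    fix m
    have "real m \<le> real n \<or> real (n + 1) \<le> real m"
      unfolding of_nat_le_iff by linarith
    then show "{2 * real n + 1<..<min b (2 * real n + 2)} \<inter> {2 * real m<..<2 * real m + 1} = {}"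
      by auto
  qed (use assms in auto)
  then show ?thesis
    by (rule contrapos_nn) (auto elim!: finite_subset [rotated])
qed

lemma not_islimpt_gap_set:
  assumes "n \<in> A" "x \<in> {2 * real n<..<2 * real n + 1}"
  shows "\<not> x islimpt gap_set A"
proof
  assume "x islimpt gap_set A"
  then have "infinite ({2 * real n<..<2 * real n + 1} \<inter> gap_set A)"
    unfolding islimpt_eq_acc_point using assms(2) open_greaterThanLessThan by blast
  then show False
    unfolding Int_commute [of _ "gap_set A"]
    using finite_gap_set_Int_gap [OF assms(1)] by simp
qed

text \<open>The ends of a thinned interval are limit points because rationals accumulate from
  outside. Conversely, limit points with only finitely many points of the set between them must be
  the ends of a thinned interval.\<close>

lemma gap_numbers_gap_set: "gap_numbers (gap_set A) = A"
proof
  show "A \<subseteq> gap_numbers (gap_set A)"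
  proof
    fix n
    assume n: "n \<in> A"
    have "2 * real n islimpt gap_set A"
      unfolding islimpt_approachable
    proof (intro allI impI)
      fix e :: real
      assume "0 < e"
      then have "gap_set A \<inter> {2 * real n - e<..<2 * real n} \<noteq> {}"
        using infinite_gap_set_below [of "2 * real n - e" n A] by force
      then obtain x where "x \<in> gap_set A" "2 * real n - e < x" "x < 2 * real n"
        by auto
      then show "\<exists>x'\<in>gap_set A. x' \<noteq> 2 * real n \<and> dist x' (2 * real n) < e"
        by (intro bexI [of _ x]) (auto simp: dist_real_def)
    qed
    moreover have "2 * real n + 1 islimpt gap_set A"
      unfolding islimpt_approachable
    proof (intro allI impI)
      fix e :: real
      assume "0 < e"
      then have "gap_set A \<inter> {2 * real n + 1<..<2 * real n + 1 + e} \<noteq> {}"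
        using infinite_gap_set_above [of n "2 * real n + 1 + e" A] by force
      then obtain x where "x \<in> gap_set A" "2 * real n + 1 < x" "x < 2 * real n + 1 + e"
        by auto
      then show "\<exists>x'\<in>gap_set A. x' \<noteq> 2 * real n + 1 \<and> dist x' (2 * real n + 1) < e"
        by (intro bexI [of _ x]) (auto simp: dist_real_def)
    qed
    moreover have "open_segment (2 * real n) (2 * real n + 1) = {2 * real n<..<2 * real n + 1}"
      by (simp add: open_segment_eq_real_ivl)
    ultimately show "n \<in> gap_numbers (gap_set A)"
      unfolding gap_numbers_def
      using finite_gap_set_Int_gap [OF n] card_gap_set_Int_gap [OF n]
      by (intro CollectI exI [of _ "2 * real n"] exI [of _ "2 * real n + 1"]) simp
  qed
next
  have *: "k \<in> A" if uv: "u < v" "u islimpt gap_set A" "v islimpt gap_set A"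
    "finite (gap_set A \<inter> {u<..<v})" "card (gap_set A \<inter> {u<..<v}) = k" for u v k
  proof -
    \<comment> \<open>A segment missing all thinned intervals would contain infinitely many
      rationals of the set.\<close>
    obtain n where n: "n \<in> A" "{u<..<v} \<inter> {2 * real n<..<2 * real n + 1} \<noteq> {}"
      using infinite_gap_set_Int [OF uv(1)] uv(4) by blast
    from n(2) have "\<exists>w. w \<in> {u<..<v} \<and> w \<in> {2 * real n<..<2 * real n + 1}"
      by blast
    then obtain w where "u < w" "w < v" "2 * real n < w" "w < 2 * real n + 1"
      unfolding greaterThanLessThan_iff by blast
    moreover have "\<not> (2 * real n < u \<and> u < 2 * real n + 1)" "\<not> (2 * real n < v \<and> v < 2 * real n + 1)"
      using not_islimpt_gap_set [OF n(1)] uv by auto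
    ultimately have "u \<le> 2 * real n" "2 * real n + 1 \<le> v"
      by linarith+
    \<comment> \<open>Reaching beyond the thinned interval on either side would again catch
      infinitely many points.\<close>
    moreover have "\<not> u < 2 * real n"
    proof
      assume "u < 2 * real n"
      then have "infinite (gap_set A \<inter> {u<..<2 * real n})"
        by (rule infinite_gap_set_below)
      moreover have "gap_set A \<inter> {u<..<2 * real n} \<subseteq> gap_set A \<inter> {u<..<v}"
        using \<open>2 * real n + 1 \<le> v\<close> by auto
      ultimately show False
        using uv(4) finite_subset by blast
    qed
    moreover have "\<not> 2 * real n + 1 < v"
    proof
      assume "2 * real n + 1 < v"
      then have "infinite (gap_set A \<inter> {2 * real n + 1<..<v})"
        by (rule infinite_gap_set_above)
      moreover have "gap_set A \<inter> {2 * real n + 1<..<v} \<subseteq> gap_set A \<inter> {u<..<v}"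
        using \<open>u \<le> 2 * real n\<close> by auto
      ultimately show False
        using uv(4) finite_subset by blast
    qed
    ultimately have "u = 2 * real n" "v = 2 * real n + 1"
      by simp_all
    then show ?thesis
      using card_gap_set_Int_gap [OF n(1)] uv(5) n(1) by simp
  qed
  show "gap_numbers (gap_set A) \<subseteq> A"
  proof
    fix k
    assume "k \<in> gap_numbers (gap_set A)"
    then obtain u v where uv: "u \<noteq> v" "u islimpt gap_set A" "v islimpt gap_set A"
      "finite (gap_set A \<inter> open_segment u v)" "card (gap_set A \<inter> open_segment u v) = k"
      unfolding gap_numbers_def by blast
    show "k \<in> A"
    proof (cases "u < v")
      case True
      then show ?thesis
        using * [of u v k] uv by (simp add: open_segment_eq_real_ivl)
    next
      case False
      then show ?thesis
        using * [of v u k] uv by (simp add: open_segment_eq_real_ivl)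
    qed
  qed
qed

lemma countable_gap_set: "countable (gap_set A)"
  unfolding gap_set_def
  by (intro countable_Un countable_UN countable_image countable_Diff countable_rat)
    (auto intro: countable_subset [OF subset_UNIV])

lemma infinite_gap_set: "infinite (gap_set A)"
  using infinite_gap_set_below [of "-1" 0 A] by (auto elim: contrapos_nn)

section \<open>The topologies indexed by sets of natural numbers\<close>

definition gap_topology :: "nat set \<Rightarrow> real topology" where
  "gap_topology A = refined_topology (bumps_at (from_nat_into (gap_set A)))"

lemma
  shows inj_from_nat_into_gap_set: "inj (from_nat_into (gap_set A))"
    and range_from_nat_into_gap_set: "range (from_nat_into (gap_set A)) = gap_set A"
  using bij_betw_from_nat_into [OF countable_gap_set infinite_gap_set, of A]
  by (auto simp: bij_betw_def)

text \<open>Hence \<open>gap_set A\<close> can be recovered from the topology together with the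
  Euclidean segments.\<close>

lemma segment_regular_gap_topology:
  "segment_regular (gap_topology A) x \<longleftrightarrow> x \<notin> gap_set A"
  unfolding gap_topology_def
  by (simp add: segment_regular_bumps_at_iff inj_from_nat_into_gap_set range_from_nat_into_gap_set)

lemma first_category_gap_topology: "first_category_space (gap_topology A)"
  unfolding gap_topology_def
  by (rule first_category_refined [OF continuous_bumps_at countable_gap_set tendsto_bumps_at])
    (simp add: range_from_nat_into_gap_set)

text \<open>Precomposing with the identity from the Euclidean line turns \<open>h\<close> into a
  path, which stays on its sheets.\<close>

lemma continuous_on_if_continuous_map_gap_topology:
  assumes "continuous_map (gap_topology A) (gap_topology B) h"
  shows "continuous_on UNIV h"
proof -
  have "continuous_map euclidean (gap_topology A) id"
    by (auto simp: continuous_map_def gap_topology_def open_if_openin_refined [OF continuous_bumps_at])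
  then have "continuous_map euclidean (gap_topology B) (h \<circ> id)"
    using assms by (rule continuous_map_compose)
  then show ?thesis
    unfolding gap_topology_def by (auto intro: continuous_on_if_continuous_refined)
qed

text \<open>A homeomorphism and its inverse are Euclidean continuous, so they preserve irregular
  points; thus \<open>gap_set A\<close> is mapped onto \<open>gap_set B\<close>, and
  \<open>gap_numbers\<close> decodes the index sets.\<close>

lemma homeomorphic_gap_topology_subset:
  assumes "gap_topology A homeomorphic_space gap_topology B"
  shows "A \<subseteq> B"
proof -
  obtain h k where hk: "homeomorphic_maps (gap_topology A) (gap_topology B) h k"
    using assms unfolding homeomorphic_space_def by blast
  have top: "topspace (gap_topology C) = UNIV" for C
    by (simp add: gap_topology_def)
  from hk have hom: "homeomorphic_map (gap_topology A) (gap_topology B) h"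
    "homeomorphic_map (gap_topology B) (gap_topology A) k"
    by (auto simp: homeomorphic_maps_map)
  have inv: "k (h x) = x" "h (k y) = y" for x y
    using hk by (auto simp: homeomorphic_maps_def top)
  have cont: "continuous_on UNIV h" "continuous_on UNIV k"
    using hom by (auto dest: homeomorphic_imp_continuous_map
        intro: continuous_on_if_continuous_map_gap_topology)
  have "inj h"
    by (metis injI inv(1))
  have mem: "h x \<in> gap_set B \<longleftrightarrow> x \<in> gap_set A" for x
    using segment_regular_homeomorphic_image [OF hom(1) top top cont(1), of x]
      segment_regular_homeomorphic_image [OF hom(2) top top cont(2), of "h x"]
    unfolding segment_regular_gap_topology inv by blast
  have "h ` gap_set A = gap_set B"
  proof
    show "h ` gap_set A \<subseteq> gap_set B"
      using mem by auto
    show "gap_set B \<subseteq> h ` gap_set A"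
    proof
      fix y
      assume "y \<in> gap_set B"
      then have "k y \<in> gap_set A"
        using mem [of "k y"] inv(2) by simp
      then show "y \<in> h ` gap_set A"
        using inv(2) by (intro image_eqI [of _ _ "k y"]) simp_all
    qed
  qed
  then show ?thesis
    using gap_numbers_image_subset [OF cont(1) \<open>inj h\<close>, of "gap_set A"]
    by (simp add: gap_numbers_gap_set)
qed

theorem theorem6:
  shows "\<exists>\<T>. \<T> \<subseteq> L_topologies \<and> \<T> \<approx> (UNIV :: real set) \<and>
     (\<forall>\<tau>\<in>\<T>. metrizable_space \<tau> \<and> first_category_space \<tau>) \<and>
     (\<forall>\<tau>1\<in>\<T>. \<forall>\<tau>2\<in>\<T>. \<tau>1 \<noteq> \<tau>2 \<longrightarrow> \<not> (\<tau>1 homeomorphic_space \<tau>2))"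
proof (intro exI [of _ "range gap_topology"] conjI ballI impI)
  \<comment> \<open>Homeomorphism is symmetric, so the inclusion holds in both directions.\<close>
  have eq: "A = B" if "gap_topology A homeomorphic_space gap_topology B" for A B
    using that homeomorphic_gap_topology_subset homeomorphic_space_sym by blast
  have "inj gap_topology"
    by (rule injI) (metis eq homeomorphic_space_refl)
  \<comment> \<open>By injectivity the family is equipollent to the power set of the natural
    numbers.\<close>
  then show "range gap_topology \<approx> (UNIV :: real set)"
    using inj_on_image_eqpoll_self nat_sets_eqpoll_reals eqpoll_trans by blast
  show "range gap_topology \<subseteq> L_topologies"
    by (auto simp: gap_topology_def intro: refined_topology_in_L continuous_bumps_at)
  fix \<tau>1 \<tau>2
  assume "\<tau>1 \<in> range gap_topology"
  then show "metrizable_space \<tau>1" "first_category_space \<tau>1"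
    by (auto simp: first_category_gap_topology) (simp add: gap_topology_def metrizable_refined)
  assume "\<tau>2 \<in> range gap_topology" "\<tau>1 \<noteq> \<tau>2"
  with \<open>\<tau>1 \<in> range gap_topology\<close> show "\<not> \<tau>1 homeomorphic_space \<tau>2"
    using eq by blast
qed

end
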